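(* For every $p\in(1,2]$ there is a constant $c_p>0$ depending only on $p$ such that the following holds. Let $d\ge1$, $q\in[1,2]$, $\bar L>0$, $\Delta>0$, $\sigma_1\ge0$ and $0<\varepsilon\le\frac18\sqrt{\bar L\Delta}$. If an algorithm in the global stochastic model using $T$ samples returns, for every problem instance in dimension $d$ with parameters $(\Delta,\bar L,q,\sigma_1,p)$, a point $\widehat x$ with $\mathbb E\|\nabla F(\widehat x)\|\le\varepsilon$, then $$T\ \ge\ c_p\left(\frac{\sigma_1}{\varepsilon}\right)^{\frac p{p-1}}.$$
   Context: $\|\cdot\|$ is the Euclidean norm. A problem instance in dimension $d$ with parameters $(\Delta,\bar L,q,\sigma_1,p)$ is a triple $(\mathcal Z,f,\mathcal D)$, where $\mathcal Z$ is a measurable set, $f:\mathbb R^d\times\mathcal Z\to\mathbb R$ is differentiable in its first argument, and $\mathcal D$ is a probability distribution on $\mathcal Z$, such that $F(x):=\mathbb E_{\xi\sim\mathcal D}[f(x,\xi)]$ satisfies $F(0)-\inf_xF(x)\le\Delta$ and, for all $x,y\in\mathbb R^d$, $\mathbb E_\xi[\nabla f(x,\xi)]=\nabla F(x)$, $\mathbb E_\xi\|\nabla f(x,\xi)-\nabla F(x)\|^p\le\sigma_1^p$, $\mathbb E_\xi\|\nabla f(x,\xi)-\nabla f(y,\xi)\|^q\le\bar L^q\|x-y\|^q$ (gradients with respect to $x$). Global stochastic model: the algorithm knows $\mathcal Z$ and the whole function $f(\cdot,\cdot)$ but not $\mathcal D$; it receives $T$ i.i.d. samples $\xi_1,\dots,\xi_T\sim\mathcal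 D$ and outputs a point $\widehat x=\widehat x(\xi_1,\dots,\xi_T)\in\mathbb R^d$, which is a measurable function of the samples and possibly of independent internal randomness. The expectation is over samples and internal randomness. *)

theory Defs
  imports "HOL-Probability.Probability"
begin

text \<open>
  The dimension \<open>d\<close> has to be quantified after the constant \<open>c\<close>, so it cannot be a type.
  The space \<open>\<real>\<^sup>d\<close> is the set of extensional functions \<open>{..<d} \<rightarrow>\<^sub>E UNIV\<close>, which is the
  carrier of the product measurable space \<open>Rd d\<close>; its product sigma-algebra is the Borel
  sigma-algebra of \<open>\<real>\<^sup>d\<close>.
\<close>

definition Rd :: "nat \<Rightarrow> (nat \<Rightarrow> real) measure" where
  "Rd d = PiM {..<d} (\<lambda>_. borel)"

abbreviation Rd_points :: "nat \<Rightarrow> (nat \<Rightarrow> real) set" where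
  "Rd_points d \<equiv> space (Rd d)"

definition zero_vec :: "nat \<Rightarrow> nat \<Rightarrow> real" where
  "zero_vec d = (\<lambda>i\<in>{..<d}. 0)"

definition diff_vec :: "nat \<Rightarrow> (nat \<Rightarrow> real) \<Rightarrow> (nat \<Rightarrow> real) \<Rightarrow> nat \<Rightarrow> real" where
  "diff_vec d x y = (\<lambda>i\<in>{..<d}. x i - y i)"

definition inner_vec :: "nat \<Rightarrow> (nat \<Rightarrow> real) \<Rightarrow> (nat \<Rightarrow> real) \<Rightarrow> real" where
  "inner_vec d x y = (\<Sum>i<d. x i * y i)"

definition norm_vec :: "nat \<Rightarrow> (nat \<Rightarrow> real) \<Rightarrow> real" where
  "norm_vec d x = sqrt (\<Sum>i<d. (x i)\<^sup>2)"

definition has_gradient ::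
    "nat \<Rightarrow> ((nat \<Rightarrow> real) \<Rightarrow> real) \<Rightarrow> (nat \<Rightarrow> real) \<Rightarrow> (nat \<Rightarrow> real) \<Rightarrow> bool" where
  "has_gradient d h x g \<longleftrightarrow>
     g \<in> Rd_points d \<and>
     (\<forall>e>0. \<exists>\<delta>>0. \<forall>y\<in>Rd_points d. norm_vec d (diff_vec d y x) < \<delta> \<longrightarrow>
        \<bar>h y - h x - inner_vec d g (diff_vec d y x)\<bar> \<le> e * norm_vec d (diff_vec d y x))"

definition differentiable_Rd :: "nat \<Rightarrow> ((nat \<Rightarrow> real) \<Rightarrow> real) \<Rightarrow> bool" where
  "differentiable_Rd d h \<longleftrightarrow> (\<forall>x\<in>Rd_points d. \<exists>g. has_gradient d h x g)"

definition gradient :: "nat \<Rightarrow> ((nat \<Rightarrow> real) \<Rightarrow> real) \<Rightarrow> (nat \<Rightarrow> real) \<Rightarrow> nat \<Rightarrow> real" where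
  "gradient d h x = (THE g. has_gradient d h x g)"

lemma has_gradient_unique:
  assumes x: "x \<in> Rd_points d" and g: "has_gradient d h x g" and g': "has_gradient d h x g'"
  shows "g = g'"
proof -
  have eq: "g i = g' i" if i: "i < d" for i
  proof (rule ccontr)
    assume ne: "g i \<noteq> g' i"
    define e where "e = \<bar>g i - g' i\<bar> / 4"
    have e: "e > 0" using ne by (simp add: e_def)
    obtain \<delta>1 where d1: "\<delta>1 > 0"
      "\<And>y. y \<in> Rd_points d \<Longrightarrow> norm_vec d (diff_vec d y x) < \<delta>1 \<Longrightarrow>
        \<bar>h y - h x - inner_vec d g (diff_vec d y x)\<bar> \<le> e * norm_vec d (diff_vec d y x)"
      using g e unfolding has_gradient_def by blast
    obtain \<delta>2 where d2: "\<delta>2 > 0"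
      "\<And>y. y \<in> Rd_points d \<Longrightarrow> norm_vec d (diff_vec d y x) < \<delta>2 \<Longrightarrow>
        \<bar>h y - h x - inner_vec d g' (diff_vec d y x)\<bar> \<le> e * norm_vec d (diff_vec d y x)"
      using g' e unfolding has_gradient_def by blast
    define t where "t = min \<delta>1 \<delta>2 / 2"
    have t: "t > 0" "t < \<delta>1" "t < \<delta>2" using d1(1) d2(1) by (auto simp: t_def min_def)
    define y where "y = x(i := x i + t)"
    have y: "y \<in> Rd_points d" using x i
      by (auto simp: y_def Rd_def space_PiM PiE_iff extensional_def)
    have dv: "diff_vec d y x j = (if j = i then t else 0)" if "j < d" for j
      using that by (simp add: diff_vec_def y_def)
    have "norm_vec d (diff_vec d y x) = sqrt (\<Sum>j<d. if j = i then t\<^sup>2 else 0)"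
      unfolding norm_vec_def by (intro arg_cong[where f = sqrt] sum.cong) (auto simp: dv)
    then have nrm: "norm_vec d (diff_vec d y x) = t" using t i by simp
    have inn: "inner_vec d k (diff_vec d y x) = k i * t" for k
    proof -
      have "inner_vec d k (diff_vec d y x) = (\<Sum>j<d. if j = i then k i * t else 0)"
        unfolding inner_vec_def by (intro sum.cong) (auto simp: dv)
      then show ?thesis using i by simp
    qed
    have "\<bar>h y - h x - g i * t\<bar> \<le> e * t" "\<bar>h y - h x - g' i * t\<bar> \<le> e * t"
      using d1(2)[OF y] d2(2)[OF y] t by (simp_all add: nrm inn)
    then have "\<bar>g i * t - g' i * t\<bar> \<le> 2 * e * t" by linarith
    then have "\<bar>g i - g' i\<bar> * t \<le> 2 * e * t"
      using t(1) by (simp add: abs_mult left_diff_distrib[symmetric])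
    then show False using t(1) ne by (simp add: e_def)
  qed
  have "g \<in> {..<d} \<rightarrow>\<^sub>E UNIV" "g' \<in> {..<d} \<rightarrow>\<^sub>E UNIV"
    using g g' by (simp_all add: has_gradient_def Rd_def space_PiM)
  then show ?thesis using eq by (auto intro: PiE_ext)
qed

lemma gradient_eqI: "x \<in> Rd_points d \<Longrightarrow> has_gradient d h x g \<Longrightarrow> gradient d h x = g"
  unfolding gradient_def using has_gradient_unique by blast

definition objective :: "'z measure \<Rightarrow> ((nat \<Rightarrow> real) \<Rightarrow> 'z \<Rightarrow> real) \<Rightarrow> (nat \<Rightarrow> real) \<Rightarrow> real" where
  "objective D f x = (\<integral>\<xi>. f x \<xi> \<partial>D)"

text \<open>
  \<open>Z\<close> is used only as a measurable space; its measure plays no role. The theorem takes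
  \<open>'z = real\<close>, with arbitrary carriers and sigma-algebras: a type variable would let the
  constant depend on \<open>'z\<close>, and an algorithm that succeeds on all sample spaces succeeds on
  these. The moments are nonnegative
  Lebesgue integrals, so that an infinite moment violates the bound. The integrability
  requirements say that the Bochner integrals in the definition of \<open>F\<close> and in
  \<open>E \<nabla>f(x,\<xi>) = \<nabla>F(x)\<close> exist, and \<open>bdd_below\<close> says that the infimum of \<open>F\<close> is finite.
\<close>

definition problem_instance ::
    "nat \<Rightarrow> real \<Rightarrow> real \<Rightarrow> real \<Rightarrow> real \<Rightarrow> real \<Rightarrow>
     'z measure \<Rightarrow> ((nat \<Rightarrow> real) \<Rightarrow> 'z \<Rightarrow> real) \<Rightarrow> 'z measure \<Rightarrow> bool" where
  "problem_instance d \<Delta> L q \<sigma> p Z f D \<longleftrightarrow>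
     prob_space D \<and> sets D = sets Z \<and>
     (\<forall>\<xi>\<in>space Z. differentiable_Rd d (\<lambda>x. f x \<xi>)) \<and>
     (\<forall>x\<in>Rd_points d. integrable D (f x)) \<and>
     bdd_below (objective D f ` Rd_points d) \<and>
     objective D f (zero_vec d) - (INF x\<in>Rd_points d. objective D f x) \<le> \<Delta> \<and>
     differentiable_Rd d (objective D f) \<and>
     (\<forall>x\<in>Rd_points d. \<forall>i<d.
        integrable D (\<lambda>\<xi>. gradient d (\<lambda>u. f u \<xi>) x i) \<and>
        (\<integral>\<xi>. gradient d (\<lambda>u. f u \<xi>) x i \<partial>D) = gradient d (objective D f) x i) \<and>
     (\<forall>x\<in>Rd_points d.
        (\<integral>\<^sup>+\<xi>. ennreal (norm_vec d (diff_vec d (gradient d (\<lambda>u. f u \<xi>) x)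
                                    (gradient d (objective D f) x)) powr p) \<partial>D)
          \<le> ennreal (\<sigma> powr p)) \<and>
     (\<forall>x\<in>Rd_points d. \<forall>y\<in>Rd_points d.
        (\<integral>\<^sup>+\<xi>. ennreal (norm_vec d (diff_vec d (gradient d (\<lambda>u. f u \<xi>) x)
                                    (gradient d (\<lambda>u. f u \<xi>) y)) powr q) \<partial>D)
          \<le> ennreal (L powr q * norm_vec d (diff_vec d x y) powr q))"

text \<open>
  An algorithm is given \<open>Z\<close> and \<open>f\<close>, but not \<open>D\<close>. For samples \<open>\<xi> = (\<xi> 0, \<dots>, \<xi> (T - 1))\<close>,
  the measure \<open>A Z f \<xi>\<close> is the law of the output over the internal randomness. An output
  \<open>X (\<xi>, r)\<close> that is a measurable function of the samples and of an independent seed \<open>r\<close> is of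
  this form, whatever the seed space \<open>R\<close>: see \<open>seeded_output_kernel\<close> and
  \<open>seeded_output_expectation\<close>. The kernel avoids fixing a type for the seed, on which the
  constant could otherwise depend.
\<close>

definition global_stochastic_algorithm ::
    "nat \<Rightarrow> nat \<Rightarrow>
     ('z measure \<Rightarrow> ((nat \<Rightarrow> real) \<Rightarrow> 'z \<Rightarrow> real) \<Rightarrow> (nat \<Rightarrow> 'z) \<Rightarrow> (nat \<Rightarrow> real) measure) \<Rightarrow> bool"
  where
  "global_stochastic_algorithm d T A \<longleftrightarrow>
     (\<forall>Z f. A Z f \<in> PiM {..<T} (\<lambda>_. Z) \<rightarrow>\<^sub>M prob_algebra (Rd d))"

definition expected_gradient_norm ::
    "nat \<Rightarrow> nat \<Rightarrow> ((nat \<Rightarrow> 'z) \<Rightarrow> (nat \<Rightarrow> real) measure) \<Rightarrow>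
     ((nat \<Rightarrow> real) \<Rightarrow> 'z \<Rightarrow> real) \<Rightarrow> 'z measure \<Rightarrow> ennreal" where
  "expected_gradient_norm d T K f D =
     (\<integral>\<^sup>+\<xi>. \<integral>\<^sup>+x. ennreal (norm_vec d (gradient d (objective D f) x)) \<partial>K \<xi> \<partial>PiM {..<T} (\<lambda>_. D))"

lemma seeded_output_kernel:
  assumes R: "prob_space R"
    and X: "X \<in> (PiM {..<T} (\<lambda>_. Z) \<Otimes>\<^sub>M R) \<rightarrow>\<^sub>M Rd d"
  shows "(\<lambda>\<xi>. distr R (Rd d) (\<lambda>r. X (\<xi>, r))) \<in> PiM {..<T} (\<lambda>_. Z) \<rightarrow>\<^sub>M prob_algebra (Rd d)"
proof -
  have "(\<lambda>\<xi>. distr R (Rd d) (\<lambda>r. X (\<xi>, r))) \<in> PiM {..<T} (\<lambda>_. Z) \<rightarrow>\<^sub>M subprob_algebra (Rd d)"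
    using R X by (intro measurable_distr2[where f = "\<lambda>\<xi> r. X (\<xi>, r)" and g = "\<lambda>_. R" and M = R])
      (auto simp: space_subprob_algebra prob_space_imp_subprob_space)
  moreover have "prob_space (distr R (Rd d) (\<lambda>r. X (\<xi>, r)))"
    if "\<xi> \<in> space (PiM {..<T} (\<lambda>_. Z))" for \<xi>
    using R X that by (intro prob_space.prob_space_distr) auto
  ultimately show ?thesis
    by (intro measurable_prob_algebraI)
qed

lemma seeded_output_expectation:
  fixes h :: "(nat \<Rightarrow> real) \<Rightarrow> ennreal"
  assumes R: "prob_space R" and D: "prob_space D" "sets D = sets Z"
    and X: "X \<in> (PiM {..<T} (\<lambda>_. Z) \<Otimes>\<^sub>M R) \<rightarrow>\<^sub>M Rd d" and h: "h \<in> borel_measurable (Rd d)"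
  shows "(\<integral>\<^sup>+\<xi>. \<integral>\<^sup>+x. h x \<partial>distr R (Rd d) (\<lambda>r. X (\<xi>, r)) \<partial>PiM {..<T} (\<lambda>_. D))
       = (\<integral>\<^sup>+w. h (X w) \<partial>(PiM {..<T} (\<lambda>_. D) \<Otimes>\<^sub>M R))"
proof -
  interpret R: prob_space R by fact
  have "sets (PiM {..<T} (\<lambda>_. Z)) = sets (PiM {..<T} (\<lambda>_. D))"
    using D(2) by (intro sets_PiM_cong) auto
  then have X': "X \<in> (PiM {..<T} (\<lambda>_. D) \<Otimes>\<^sub>M R) \<rightarrow>\<^sub>M Rd d"
    using X by (simp cong: measurable_cong_sets sets_pair_measure_cong)
  have hX: "(\<lambda>w. h (X w)) \<in> borel_measurable (PiM {..<T} (\<lambda>_. D) \<Otimes>\<^sub>M R)"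
    using measurable_compose[OF X' h] .
  have "(\<integral>\<^sup>+x. h x \<partial>distr R (Rd d) (\<lambda>r. X (\<xi>, r))) = (\<integral>\<^sup>+r. h (X (\<xi>, r)) \<partial>R)"
    if "\<xi> \<in> space (PiM {..<T} (\<lambda>_. D))" for \<xi>
    using that X' h by (intro nn_integral_distr) auto
  then have "(\<integral>\<^sup>+\<xi>. \<integral>\<^sup>+x. h x \<partial>distr R (Rd d) (\<lambda>r. X (\<xi>, r)) \<partial>PiM {..<T} (\<lambda>_. D))
      = (\<integral>\<^sup>+\<xi>. \<integral>\<^sup>+r. h (X (\<xi>, r)) \<partial>R \<partial>PiM {..<T} (\<lambda>_. D))"
    by (rule nn_integral_cong)
  also have "\<dots> = (\<integral>\<^sup>+w. h (X w) \<partial>(PiM {..<T} (\<lambda>_. D) \<Otimes>\<^sub>M R))"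
    using R.nn_integral_fst[OF hX] by simp
  finally show ?thesis .
qed

end

theory Submission
  imports Defs
begin

text \<open>
  The lower bound comes from two instances that look alike unless a rare event occurs among the
  samples. Both use the function \<open>f(x, \<xi>) = L/2 \<parallel>x\<parallel>\<^sup>2 + M \<xi> x\<^sub>0\<close>. Under the law with sign
  \<open>s = 1\<close> or \<open>s = -1\<close>, the sample \<open>\<xi>\<close> equals \<open>s\<close> with probability \<open>\<delta>\<close> and \<open>0\<close> otherwise. With
  \<open>M = 4 \<epsilon> / \<delta>\<close> the two objectives are \<open>L/2 \<parallel>x\<parallel>\<^sup>2 + 4 \<epsilon> x\<^sub>0\<close> and \<open>L/2 \<parallel>x\<parallel>\<^sup>2 - 4 \<epsilon> x\<^sub>0\<close>, so at every
  point their gradient norms add up to at least \<open>8 \<epsilon>\<close>. With probability \<open>(1 - \<delta>)\<^sup>T\<close> all samples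
  are \<open>0\<close>, and then the algorithm has the same output law for both signs. Its two expected
  gradient norms, each at most \<open>\<epsilon>\<close>, therefore have a sum of at least \<open>8 \<epsilon> (1 - \<delta>)\<^sup>T\<close>, which is
  at least \<open>8 \<epsilon> (1 - T \<delta>)\<close> by Bernoulli's inequality. Hence \<open>T \<delta> \<ge> 3/4\<close>
  (\<open>sample_bound_rare_sign\<close>).

  It remains to choose \<open>\<delta>\<close> as small as the noise bound permits. The \<open>p\<close>-th moment of the noise is
  at most \<open>2 \<delta> M\<^sup>p = 2 \<delta>\<^bsup>1-p\<^esup> (4 \<epsilon>)\<^sup>p\<close>, which is \<open>\<sigma>\<^sup>p\<close> when
  \<open>\<delta> = 2\<^bsup>1/(p-1)\<^esup> (4 \<epsilon> / \<sigma>)\<^bsup>p/(p-1)\<^esup>\<close>, so that \<open>1 / \<delta>\<close> is a multiple of the claimed rate. If this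
  number exceeds \<open>1\<close>, then \<open>\<delta> = 1\<close> is taken instead: the instances are noiseless, and the same
  argument shows that \<open>T \<ge> 1\<close>. The smoothness condition holds with equality, since
  \<open>\<nabla>f(x, \<xi>) - \<nabla>f(y, \<xi>) = L (x - y)\<close> for every \<open>\<xi>\<close>; and the initial gap is
  \<open>(4 \<epsilon>)\<^sup>2 / (2 L) \<le> \<Delta>\<close>.
\<close>

section \<open>Tilted quadratics\<close>

definition tilted_quadratic :: "nat \<Rightarrow> real \<Rightarrow> real \<Rightarrow> (nat \<Rightarrow> real) \<Rightarrow> real" where
  "tilted_quadratic d L a x = L / 2 * (\<Sum>i<d. (x i)\<^sup>2) + a * x 0"

definition tilted_gradient :: "nat \<Rightarrow> real \<Rightarrow> real \<Rightarrow> (nat \<Rightarrow> real) \<Rightarrow> nat \<Rightarrow> real" where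
  "tilted_gradient d L a x = (\<lambda>i\<in>{..<d}. L * x i + (if i = 0 then a else 0))"

lemma norm_vec_nonneg: "0 \<le> norm_vec d x"
  unfolding norm_vec_def by (intro real_sqrt_ge_zero sum_nonneg) auto

lemma norm_vec_square: "(norm_vec d x)\<^sup>2 = (\<Sum>i<d. (x i)\<^sup>2)"
  unfolding norm_vec_def by (simp add: sum_nonneg)

lemma abs_component_le_norm_vec:
  assumes "i < d"
  shows "\<bar>x i\<bar> \<le> norm_vec d x"
proof -
  have "(x i)\<^sup>2 \<le> (\<Sum>j<d. (x j)\<^sup>2)"
    using assms by (intro member_le_sum) auto
  then have "sqrt ((x i)\<^sup>2) \<le> norm_vec d x"
    unfolding norm_vec_def by (rule real_sqrt_le_mono)
  then show ?thesis by simp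
qed

lemma norm_vec_single:
  assumes "1 \<le> d"
  shows "norm_vec d (\<lambda>i\<in>{..<d}. if i = 0 then a else 0) = \<bar>a\<bar>"
proof -
  have "(\<Sum>i<d. ((\<lambda>i\<in>{..<d}. if i = 0 then a else 0) i)\<^sup>2) = (\<Sum>i<d. if i = 0 then a\<^sup>2 else 0)"
    by (intro sum.cong) auto
  also have "\<dots> = a\<^sup>2" using assms by simp
  finally show ?thesis unfolding norm_vec_def by simp
qed

lemma norm_vec_scale:
  "norm_vec d (\<lambda>i\<in>{..<d}. L * x i) = \<bar>L\<bar> * norm_vec d x"
proof -
  have "(\<Sum>i<d. ((\<lambda>i\<in>{..<d}. L * x i) i)\<^sup>2) = L\<^sup>2 * (\<Sum>i<d. (x i)\<^sup>2)"
    unfolding sum_distrib_left by (intro sum.cong) (auto simp: power_mult_distrib)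
  then show ?thesis unfolding norm_vec_def by (simp add: real_sqrt_mult)
qed

lemma tilted_gradient_diff_tilt:
  "diff_vec d (tilted_gradient d L a x) (tilted_gradient d L b x) =
     (\<lambda>i\<in>{..<d}. if i = 0 then a - b else 0)"
  by (auto simp: diff_vec_def tilted_gradient_def)

lemma tilted_gradient_diff_point:
  "diff_vec d (tilted_gradient d L a x) (tilted_gradient d L a y) =
     (\<lambda>i\<in>{..<d}. L * diff_vec d x y i)"
  by (auto simp: diff_vec_def tilted_gradient_def algebra_simps)

text \<open>The Taylor remainder of a tilted quadratic at \<open>x\<close> is exactly \<open>L/2 \<parallel>y - x\<parallel>\<^sup>2\<close>.\<close>

lemma has_gradient_tilted_quadratic:
  assumes d: "1 \<le> d" and L: "0 < L"
  shows "has_gradient d (tilted_quadratic d L a) x (tilted_gradient d L a x)"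
proof -
  have taylor: "tilted_quadratic d L a y - tilted_quadratic d L a x
      - inner_vec d (tilted_gradient d L a x) (diff_vec d y x)
      = L / 2 * (norm_vec d (diff_vec d y x))\<^sup>2" for y
  proof -
    have "inner_vec d (tilted_gradient d L a x) (diff_vec d y x)
        = (\<Sum>i<d. L * x i * (y i - x i) + (if i = 0 then a * (y 0 - x 0) else 0))"
      unfolding inner_vec_def by (intro sum.cong) (auto simp: tilted_gradient_def diff_vec_def algebra_simps)
    also have "\<dots> = (\<Sum>i<d. L * x i * (y i - x i)) + a * (y 0 - x 0)"
      using d by (simp add: sum.distrib)
    finally have inner: "inner_vec d (tilted_gradient d L a x) (diff_vec d y x)
        = (\<Sum>i<d. L * x i * (y i - x i)) + a * (y 0 - x 0)" .
    have "(\<Sum>i<d. L / 2 * (y i)\<^sup>2) - (\<Sum>i<d. L / 2 * (x i)\<^sup>2) - (\<Sum>i<d. L * x i * (y i - x i))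
        = (\<Sum>i<d. L / 2 * (diff_vec d y x i)\<^sup>2)"
      unfolding sum_subtractf[symmetric]
      by (intro sum.cong) (auto simp: diff_vec_def power2_eq_square field_simps)
    then show ?thesis
      unfolding inner norm_vec_square tilted_quadratic_def sum_distrib_left
      by (simp add: algebra_simps)
  qed
  have "\<exists>\<delta>>0. \<forall>y\<in>Rd_points d. norm_vec d (diff_vec d y x) < \<delta> \<longrightarrow>
        \<bar>tilted_quadratic d L a y - tilted_quadratic d L a x
          - inner_vec d (tilted_gradient d L a x) (diff_vec d y x)\<bar> \<le> e * norm_vec d (diff_vec d y x)"
    if e: "e > 0" for e
  proof (intro exI[of _ "2 * e / L"] conjI ballI impI)
    show "2 * e / L > 0" using e L by simp
    fix y assume small: "norm_vec d (diff_vec d y x) < 2 * e / L"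
    let ?r = "norm_vec d (diff_vec d y x)"
    have "L / 2 * ?r \<le> e" using small L by (simp add: field_simps)
    then have "L / 2 * ?r * ?r \<le> e * ?r" using norm_vec_nonneg by (rule mult_right_mono)
    then show "\<bar>tilted_quadratic d L a y - tilted_quadratic d L a x
          - inner_vec d (tilted_gradient d L a x) (diff_vec d y x)\<bar> \<le> e * ?r"
      unfolding taylor using L by (simp add: power2_eq_square abs_mult mult.assoc)
  qed
  moreover have "tilted_gradient d L a x \<in> Rd_points d"
    by (auto simp: tilted_gradient_def Rd_def space_PiM)
  ultimately show ?thesis unfolding has_gradient_def by blast
qed

lemma gradient_tilted_quadratic:
  assumes "1 \<le> d" "0 < L" "x \<in> Rd_points d"
  shows "gradient d (tilted_quadratic d L a) x = tilted_gradient d L a x"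
  using assms by (intro gradient_eqI has_gradient_tilted_quadratic) auto

lemma differentiable_tilted_quadratic:
  assumes "1 \<le> d" "0 < L"
  shows "differentiable_Rd d (tilted_quadratic d L a)"
  unfolding differentiable_Rd_def using has_gradient_tilted_quadratic[OF assms] by blast

text \<open>Completing the square in the coordinate \<open>0\<close>; the other coordinates only add to the value.\<close>

lemma tilted_quadratic_lower_bound:
  assumes d: "1 \<le> d" and L: "0 < L"
  shows "- (a\<^sup>2 / (2 * L)) \<le> tilted_quadratic d L a x"
proof -
  have "(x 0)\<^sup>2 \<le> (\<Sum>i<d. (x i)\<^sup>2)" using d by (intro member_le_sum) auto
  then have "L / 2 * (x 0)\<^sup>2 + a * x 0 \<le> tilted_quadratic d L a x"
    unfolding tilted_quadratic_def using L by simp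
  moreover have "L / 2 * (x 0)\<^sup>2 + a * x 0 + a\<^sup>2 / (2 * L) = (L * x 0 + a)\<^sup>2 / (2 * L)"
    using L by (simp add: field_simps power2_eq_square)
  moreover have "(L * x 0 + a)\<^sup>2 / (2 * L) \<ge> 0" using L by simp
  ultimately show ?thesis by linarith
qed

section \<open>The two hard instances\<close>

definition rare_sign :: "real \<Rightarrow> real \<Rightarrow> real pmf" where
  "rare_sign \<delta> s = map_pmf (\<lambda>b. if b then s else 0) (bernoulli_pmf \<delta>)"

definition noisy_quadratic :: "nat \<Rightarrow> real \<Rightarrow> real \<Rightarrow> (nat \<Rightarrow> real) \<Rightarrow> real \<Rightarrow> real" where
  "noisy_quadratic d L M x \<xi> = tilted_quadratic d L (M * \<xi>) x"

lemma integrable_rare_sign: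
  fixes g :: "real \<Rightarrow> real"
  shows "integrable (measure_pmf (rare_sign \<delta> s)) g"
proof (rule integrable_measure_pmf_finite)
  have "set_pmf (rare_sign \<delta> s) \<subseteq> {s, 0}" by (auto simp: rare_sign_def)
  then show "finite (set_pmf (rare_sign \<delta> s))" by (rule finite_subset) simp
qed

lemma integral_rare_sign:
  fixes g :: "real \<Rightarrow> real"
  assumes "0 \<le> \<delta>" "\<delta> \<le> 1"
  shows "(\<integral>\<xi>. g \<xi> \<partial>measure_pmf (rare_sign \<delta> s)) = \<delta> * g s + (1 - \<delta>) * g 0"
  using assms by (simp add: rare_sign_def)

lemma nn_integral_rare_sign:
  fixes g :: "real \<Rightarrow> real"
  assumes "0 \<le> \<delta>" "\<delta> \<le> 1" "\<And>\<xi>. 0 \<le> g \<xi>"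
  shows "(\<integral>\<^sup>+\<xi>. ennreal (g \<xi>) \<partial>measure_pmf (rare_sign \<delta> s)) = ennreal (\<delta> * g s + (1 - \<delta>) * g 0)"
  using nn_integral_eq_integral[OF integrable_rare_sign[where g = g and \<delta> = \<delta> and s = s]]
    integral_rare_sign[OF assms(1,2), where g = g and s = s] assms(3)
  by simp

lemma objective_noisy_quadratic:
  assumes "0 \<le> \<delta>" "\<delta> \<le> 1"
  shows "objective (measure_pmf (rare_sign \<delta> s)) (noisy_quadratic d L M)
    = tilted_quadratic d L (\<delta> * M * s)"
proof
  fix x
  show "objective (measure_pmf (rare_sign \<delta> s)) (noisy_quadratic d L M) x
    = tilted_quadratic d L (\<delta> * M * s) x"
    unfolding objective_def integral_rare_sign[OF assms] noisy_quadratic_def tilted_quadratic_def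
    by (simp add: field_simps)
qed

lemma problem_instance_noisy_quadratic:
  assumes d: "1 \<le> d" and L: "0 < L" and \<delta>: "0 \<le> \<delta>" "\<delta> \<le> 1" and M: "0 \<le> M" and s: "\<bar>s\<bar> = 1"
    and gap: "(\<delta> * M)\<^sup>2 \<le> 2 * L * \<Delta>"
    and moment: "\<delta> * ((1 - \<delta>) * M) powr p + (1 - \<delta>) * (\<delta> * M) powr p \<le> \<sigma> powr p"
  shows "problem_instance d \<Delta> L q \<sigma> p (count_space UNIV) (noisy_quadratic d L M)
    (measure_pmf (rare_sign \<delta> s))"
proof -
  let ?D = "measure_pmf (rare_sign \<delta> s)" and ?f = "noisy_quadratic d L M" and ?a = "\<delta> * M * s"
  have obj: "objective ?D ?f = tilted_quadratic d L ?a"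
    using objective_noisy_quadratic[OF \<delta>] .
  have fun_f: "(\<lambda>x. ?f x \<xi>) = tilted_quadratic d L (M * \<xi>)" for \<xi>
    by (simp add: noisy_quadratic_def fun_eq_iff)
  note grad = gradient_tilted_quadratic[OF d L]
  have below: "bdd_below (tilted_quadratic d L ?a ` Rd_points d)"
    using tilted_quadratic_lower_bound[OF d L] by (intro bdd_belowI2)
  have zero: "zero_vec d \<in> Rd_points d" by (auto simp: zero_vec_def Rd_def space_PiM)
  have initial_gap: "tilted_quadratic d L ?a (zero_vec d)
      - (INF x\<in>Rd_points d. tilted_quadratic d L ?a x) \<le> \<Delta>"
  proof -
    have "- (?a\<^sup>2 / (2 * L)) \<le> (INF x\<in>Rd_points d. tilted_quadratic d L ?a x)"
      using zero tilted_quadratic_lower_bound[OF d L] by (intro cINF_greatest) auto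
    moreover have "?a\<^sup>2 = (\<delta> * M)\<^sup>2"
      using s by (metis mult.right_neutral power2_abs power_mult_distrib power_one)
    then have "?a\<^sup>2 \<le> \<Delta> * (2 * L)" using gap by argo
    then have "?a\<^sup>2 / (2 * L) \<le> \<Delta>" using L by (subst pos_divide_le_eq) auto
    moreover have "tilted_quadratic d L ?a (zero_vec d) = 0"
      using d by (simp add: tilted_quadratic_def zero_vec_def)
    ultimately show ?thesis by linarith
  qed
  have unbiased: "(\<integral>\<xi>. tilted_gradient d L (M * \<xi>) x i \<partial>?D) = tilted_gradient d L ?a x i"
    if "i < d" for x i
    unfolding integral_rare_sign[OF \<delta>] using that
    by (simp add: tilted_gradient_def algebra_simps)
  have noise: "(\<integral>\<^sup>+\<xi>. ennreal (norm_vec d (diff_vec d (tilted_gradient d L (M * \<xi>) x)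
      (tilted_gradient d L ?a x)) powr p) \<partial>?D) \<le> ennreal (\<sigma> powr p)" for x
  proof -
    have "\<bar>M * s - ?a\<bar> = (1 - \<delta>) * M"
    proof -
      have "M * s - ?a = (1 - \<delta>) * M * s" by (simp add: algebra_simps)
      then show ?thesis using s \<delta> M by (simp add: abs_mult)
    qed
    moreover have "\<bar>?a\<bar> = \<delta> * M" using s \<delta> M by (simp add: abs_mult)
    ultimately show ?thesis
      unfolding tilted_gradient_diff_tilt norm_vec_single[OF d]
      using moment by (subst nn_integral_rare_sign[OF \<delta>]) (auto intro: ennreal_leI)
  qed
  have smooth: "(\<integral>\<^sup>+\<xi>. ennreal (norm_vec d (diff_vec d (tilted_gradient d L (M * \<xi>) x)
      (tilted_gradient d L (M * \<xi>) y)) powr q) \<partial>?D)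
      \<le> ennreal (L powr q * norm_vec d (diff_vec d x y) powr q)" for x y
    unfolding tilted_gradient_diff_point norm_vec_scale
    using L norm_vec_nonneg by (simp add: powr_mult measure_pmf.emeasure_space_1)
  show ?thesis
    unfolding problem_instance_def obj fun_f
    using measure_pmf.prob_space_axioms differentiable_tilted_quadratic[OF d L] below initial_gap
      unbiased noise smooth
    by (auto simp: grad integrable_rare_sign)
qed

section \<open>Indistinguishability\<close>

text \<open>
  On the event that every sample is \<open>0\<close>, which is a single point of the sample space, the output
  law does not depend on \<open>s\<close>.
\<close>

lemma expected_gradient_norm_ge_all_zero:
  assumes \<delta>: "0 \<le> \<delta>" "\<delta> \<le> 1" and s: "s \<noteq> 0"
  shows "ennreal ((1 - \<delta>) ^ T)
      * (\<integral>\<^sup>+x. ennreal (norm_vec d (gradient d (objective (measure_pmf (rare_sign \<delta> s)) f) x))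
          \<partial>K (\<lambda>i\<in>{..<T}. 0))
    \<le> expected_gradient_norm d T K f (measure_pmf (rare_sign \<delta> s))"
proof -
  let ?D = "measure_pmf (rare_sign \<delta> s)" and ?\<omega> = "\<lambda>i\<in>{..<T}. 0 :: real"
  let ?P = "PiM {..<T} (\<lambda>_. ?D)"
  let ?g = "\<lambda>\<xi>. \<integral>\<^sup>+x. ennreal (norm_vec d (gradient d (objective ?D f) x)) \<partial>K \<xi>"
  interpret product_prob_space "\<lambda>_. ?D" "{..<T}" by unfold_locales
  have point: "{?\<omega>} = (\<Pi>\<^sub>E i\<in>{..<T}. {0})" by (simp add: PiE_singleton)
  have meas: "{?\<omega>} \<in> sets ?P" unfolding point by (intro sets_PiM_I_finite) auto
  have "emeasure ?D {0} = ennreal (1 - \<delta>)"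
    using nn_integral_rare_sign[OF \<delta>, where g = "indicator {0}" and s = s] s by (simp add: ennreal_indicator)
  then have "emeasure ?P {?\<omega>} = ennreal (1 - \<delta>) ^ T"
    unfolding point by (subst emeasure_PiM) auto
  then have mass: "emeasure ?P {?\<omega>} = ennreal ((1 - \<delta>) ^ T)"
    using \<delta> by (simp add: ennreal_power)
  have "ennreal ((1 - \<delta>) ^ T) * ?g ?\<omega> = (\<integral>\<^sup>+\<xi>. ?g ?\<omega> * indicator {?\<omega>} \<xi> \<partial>?P)"
    using meas by (subst nn_integral_cmult_indicator) (simp_all add: mass mult.commute)
  also have "\<dots> \<le> (\<integral>\<^sup>+\<xi>. ?g \<xi> \<partial>?P)"
    by (intro nn_integral_mono) (auto split: split_indicator)
  finally show ?thesis unfolding expected_gradient_norm_def .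
qed

text \<open>
  The components \<open>L x\<^sub>0 + a\<close> and \<open>L x\<^sub>0 - a\<close> of the two gradients cannot both be small.
\<close>

lemma opposite_tilts_gradient_sum:
  assumes d: "1 \<le> d" and L: "0 < L" and a: "0 \<le> a"
    and K: "prob_space K" "sets K = sets (Rd d)"
  shows "ennreal (2 * a)
    \<le> (\<integral>\<^sup>+x. ennreal (norm_vec d (gradient d (tilted_quadratic d L a) x)) \<partial>K)
      + (\<integral>\<^sup>+x. ennreal (norm_vec d (gradient d (tilted_quadratic d L (- a)) x)) \<partial>K)"
proof -
  interpret prob_space K by fact
  have space_K: "space K = Rd_points d" using K(2) by (rule sets_eq_imp_space_eq)
  have component: "(\<lambda>x. x 0) \<in> borel_measurable K"
  proof -
    have "(\<lambda>x. x 0) \<in> borel_measurable (Rd d)"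
      unfolding Rd_def using d by (intro measurable_component_singleton) auto
    then show ?thesis using K(2) by (simp cong: measurable_cong_sets)
  qed
  have first: "\<bar>L * x 0 + b\<bar> \<le> norm_vec d (gradient d (tilted_quadratic d L b) x)"
    if "x \<in> space K" for x b
    using abs_component_le_norm_vec[of 0 d "tilted_gradient d L b x"] d that
    by (simp add: gradient_tilted_quadratic[OF d L] space_K) (simp add: tilted_gradient_def)
  have "ennreal (2 * a) = (\<integral>\<^sup>+x. ennreal (2 * a) \<partial>K)" by (simp add: emeasure_space_1)
  also have "\<dots> \<le> (\<integral>\<^sup>+x. ennreal \<bar>L * x 0 + a\<bar> + ennreal \<bar>L * x 0 + - a\<bar> \<partial>K)"
    using a by (intro nn_integral_mono) (simp flip: ennreal_plus add: ennreal_leI)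
  also have "\<dots> = (\<integral>\<^sup>+x. ennreal \<bar>L * x 0 + a\<bar> \<partial>K) + (\<integral>\<^sup>+x. ennreal \<bar>L * x 0 + - a\<bar> \<partial>K)"
    using component by (intro nn_integral_add) auto
  also have "\<dots> \<le> (\<integral>\<^sup>+x. ennreal (norm_vec d (gradient d (tilted_quadratic d L a) x)) \<partial>K)
      + (\<integral>\<^sup>+x. ennreal (norm_vec d (gradient d (tilted_quadratic d L (- a)) x)) \<partial>K)"
    using first by (intro add_mono nn_integral_mono ennreal_leI)
  finally show ?thesis .
qed

lemma sample_bound_rare_sign:
  assumes d: "1 \<le> d" and L: "0 < L" and \<delta>: "0 < \<delta>" "\<delta> \<le> 1" and \<epsilon>: "0 < \<epsilon>"
    and K: "K \<in> PiM {..<T} (\<lambda>_. count_space UNIV) \<rightarrow>\<^sub>M prob_algebra (Rd d)"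
    and success: "\<And>s. \<bar>s\<bar> = 1 \<Longrightarrow>
      expected_gradient_norm d T K (noisy_quadratic d L (4 * \<epsilon> / \<delta>)) (measure_pmf (rare_sign \<delta> s))
        \<le> ennreal \<epsilon>"
  shows "3 / 4 \<le> real T * \<delta>"
proof -
  let ?\<omega> = "\<lambda>i\<in>{..<T}. 0 :: real"
  let ?G = "\<lambda>a. \<integral>\<^sup>+x. ennreal (norm_vec d (gradient d (tilted_quadratic d L a) x)) \<partial>K ?\<omega>"
  have "?\<omega> \<in> space (PiM {..<T} (\<lambda>_. count_space UNIV))" by (auto simp: space_PiM)
  then have K_\<omega>: "prob_space (K ?\<omega>)" "sets (K ?\<omega>) = sets (Rd d)"
    using measurable_space[OF K] by (auto simp: space_prob_algebra)
  have obj: "objective (measure_pmf (rare_sign \<delta> s)) (noisy_quadratic d L (4 * \<epsilon> / \<delta>))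
      = tilted_quadratic d L (4 * \<epsilon> * s)" for s
    using objective_noisy_quadratic[of \<delta> s d L "4 * \<epsilon> / \<delta>"] \<delta> by simp
  have each: "ennreal ((1 - \<delta>) ^ T) * ?G (4 * \<epsilon> * s) \<le> ennreal \<epsilon>" if "\<bar>s\<bar> = 1" for s
    using order_trans[OF expected_gradient_norm_ge_all_zero success[OF that]] that \<delta>
    unfolding obj by fastforce
  have "ennreal ((1 - \<delta>) ^ T * (8 * \<epsilon>)) = ennreal ((1 - \<delta>) ^ T) * ennreal (2 * (4 * \<epsilon>))"
    using \<delta> \<epsilon> by (simp add: ennreal_mult)
  also have "\<dots> \<le> ennreal ((1 - \<delta>) ^ T) * (?G (4 * \<epsilon>) + ?G (- (4 * \<epsilon>)))"
    using \<epsilon> by (intro mult_left_mono opposite_tilts_gradient_sum[OF d L _ K_\<omega>]) auto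
  also have "\<dots> \<le> ennreal \<epsilon> + ennreal \<epsilon>"
    unfolding distrib_left using each[of 1] each[of "-1"] by (intro add_mono) auto
  also have "\<dots> = ennreal (2 * \<epsilon>)" using \<epsilon> by (simp flip: ennreal_plus)
  finally have "(1 - \<delta>) ^ T * (8 * \<epsilon>) \<le> 2 * \<epsilon>" using \<epsilon> by (simp add: ennreal_le_iff)
  then have "(1 - \<delta>) ^ T \<le> 1 / 4" using \<epsilon> by (simp add: field_simps)
  moreover have "1 - real T * \<delta> \<le> (1 - \<delta>) ^ T"
    using Bernoulli_inequality[of "- \<delta>" T] \<delta> by simp
  ultimately show ?thesis by linarith
qed

section \<open>The choice of the rare probability\<close>

text \<open>
  The rare value contributes at most \<open>\<delta> M\<^sup>p\<close> to the moment, and so does the value \<open>0\<close>, because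
  \<open>\<delta>\<^sup>p \<le> \<delta>\<close>.
\<close>

lemma rare_sign_moment_le:
  fixes p \<delta> M :: real
  assumes p: "1 \<le> p" and \<delta>: "0 < \<delta>" "\<delta> \<le> 1" and M: "0 \<le> M"
  shows "\<delta> * ((1 - \<delta>) * M) powr p + (1 - \<delta>) * (\<delta> * M) powr p \<le> 2 * \<delta> * M powr p"
proof -
  have "((1 - \<delta>) * M) powr p \<le> M powr p"
    using p \<delta> M by (intro powr_mono2) (auto simp: mult_left_le_one_le)
  then have 1: "\<delta> * ((1 - \<delta>) * M) powr p \<le> \<delta> * M powr p"
    using \<delta> by (intro mult_left_mono) auto
  have "\<delta> powr p \<le> \<delta>" using powr_mono'[of 1 p \<delta>] p \<delta> by simp
  then have "(\<delta> * M) powr p \<le> \<delta> * M powr p"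
    using \<delta> M by (simp add: powr_mult mult_right_mono)
  moreover have "(1 - \<delta>) * (\<delta> * M) powr p \<le> (\<delta> * M) powr p"
    using \<delta> by (intro mult_left_le_one_le) auto
  ultimately show ?thesis using 1 by linarith
qed

text \<open>
  The formula is the solution \<open>\<delta>\<close> of \<open>2 \<delta> (4 \<epsilon> / \<delta>)\<^sup>p = \<sigma>\<^sup>p\<close>, where \<open>r = \<sigma> / \<epsilon>\<close>. It may
  exceed \<open>1\<close>.
\<close>

definition critical_probability :: "real \<Rightarrow> real \<Rightarrow> real" where
  "critical_probability p r = (2 * (4 / r) powr p) powr (1 / (p - 1))"

lemma critical_probability_moment:
  assumes p: "1 < p" and \<epsilon>: "0 < \<epsilon>" and \<sigma>: "0 < \<sigma>"
  defines "\<delta> \<equiv> critical_probability p (\<sigma> / \<epsilon>)"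
  shows "2 * \<delta> * (4 * \<epsilon> / \<delta>) powr p = \<sigma> powr p"
proof -
  have pos: "0 < \<delta>" unfolding \<delta>_def critical_probability_def using \<epsilon> \<sigma> by simp
  have "\<delta> powr (p - 1) = 2 * (4 * \<epsilon> / \<sigma>) powr p"
    unfolding \<delta>_def critical_probability_def powr_powr using p by simp
  then have "\<delta> powr (p - 1) = 2 * (4 * \<epsilon>) powr p / \<sigma> powr p"
    using \<epsilon> \<sigma> by (simp add: powr_divide)
  moreover have "\<delta> powr (p - 1) = \<delta> powr p / \<delta>" using pos by (simp add: powr_diff)
  ultimately have "\<sigma> powr p * \<delta> powr p = 2 * \<delta> * (4 * \<epsilon>) powr p"
    using pos \<sigma> by (simp add: field_simps)
  then show ?thesis using pos \<epsilon> by (simp add: powr_divide field_simps)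
qed

lemma inverse_critical_probability:
  assumes "1 < p" "0 < r"
  shows "1 / critical_probability p r = 1 / (2 * 4 powr p) powr (1 / (p - 1)) * r powr (p / (p - 1))"
proof -
  have "2 * (4 / r) powr p = (2 * 4 powr p) / r powr p"
    using assms by (simp add: powr_divide)
  then show ?thesis
    unfolding critical_probability_def using assms by (simp add: powr_divide powr_powr)
qed

theorem lemmaC1:
  fixes p :: real
  assumes "1 < p" and "p \<le> 2"
  shows "\<exists>c>0. \<forall>(d::nat) (q::real) (L::real) (\<Delta>::real) (\<sigma>::real) (\<epsilon>::real) (T::nat)
      (A :: real measure \<Rightarrow> ((nat \<Rightarrow> real) \<Rightarrow> real \<Rightarrow> real) \<Rightarrow> (nat \<Rightarrow> real) \<Rightarrow> (nat \<Rightarrow> real) measure).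
      1 \<le> d \<longrightarrow> 1 \<le> q \<longrightarrow> q \<le> 2 \<longrightarrow> 0 < L \<longrightarrow> 0 < \<Delta> \<longrightarrow> 0 \<le> \<sigma> \<longrightarrow>
      0 < \<epsilon> \<longrightarrow> \<epsilon> \<le> 1 / 8 * sqrt (L * \<Delta>) \<longrightarrow>
      global_stochastic_algorithm d T A \<longrightarrow>
      (\<forall>Z f D. problem_instance d \<Delta> L q \<sigma> p Z f D \<longrightarrow>
         expected_gradient_norm d T (A Z f) f D \<le> ennreal \<epsilon>) \<longrightarrow>
      real T \<ge> c * (\<sigma> / \<epsilon>) powr (p / (p - 1))"
proof (intro exI[of _ "3 / 4 * (1 / (2 * 4 powr p) powr (1 / (p - 1)))"] conjI allI impI)
  show "0 < 3 / 4 * (1 / (2 * 4 powr p) powr (1 / (p - 1)))" by simp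
  fix d :: nat and q L \<Delta> \<sigma> \<epsilon> :: real and T :: nat
    and A :: "real measure \<Rightarrow> ((nat \<Rightarrow> real) \<Rightarrow> real \<Rightarrow> real) \<Rightarrow> (nat \<Rightarrow> real) \<Rightarrow> (nat \<Rightarrow> real) measure"
  assume d: "1 \<le> d" and L: "0 < L" and \<Delta>: "0 < \<Delta>" and \<sigma>: "0 \<le> \<sigma>" and \<epsilon>: "0 < \<epsilon>"
    and small: "\<epsilon> \<le> 1 / 8 * sqrt (L * \<Delta>)"
    and alg: "global_stochastic_algorithm d T A"
    and success: "\<forall>Z f D. problem_instance d \<Delta> L q \<sigma> p Z f D \<longrightarrow>
         expected_gradient_norm d T (A Z f) f D \<le> ennreal \<epsilon>"
  show "real T \<ge> 3 / 4 * (1 / (2 * 4 powr p) powr (1 / (p - 1))) * (\<sigma> / \<epsilon>) powr (p / (p - 1))"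
  proof (cases "\<sigma> = 0")
    case True
    then show ?thesis by simp
  next
    case False
    then have \<sigma>: "0 < \<sigma>" using \<sigma> by simp
    define \<delta>0 where "\<delta>0 = critical_probability p (\<sigma> / \<epsilon>)"
    define \<delta> where "\<delta> = min 1 \<delta>0"
    define M where "M = 4 * \<epsilon> / \<delta>"
    have \<delta>0: "0 < \<delta>0" unfolding \<delta>0_def critical_probability_def using \<epsilon> \<sigma> by simp
    then have \<delta>: "0 < \<delta>" "\<delta> \<le> 1" by (auto simp: \<delta>_def)
    have M: "0 \<le> M" "\<delta> * M = 4 * \<epsilon>" using \<delta> \<epsilon> by (auto simp: M_def)
    have "\<epsilon>\<^sup>2 \<le> (1 / 8 * sqrt (L * \<Delta>))\<^sup>2" using small \<epsilon> by (intro power_mono) auto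
    then have "\<epsilon>\<^sup>2 \<le> L * \<Delta> / 64" using L \<Delta> by (simp add: power_mult_distrib power_divide)
    moreover have "0 \<le> L * \<Delta>" using L \<Delta> by simp
    ultimately have gap: "(\<delta> * M)\<^sup>2 \<le> 2 * L * \<Delta>" unfolding M by (simp add: power_mult_distrib)
    have moment: "\<delta> * ((1 - \<delta>) * M) powr p + (1 - \<delta>) * (\<delta> * M) powr p \<le> \<sigma> powr p"
    proof (cases "\<delta>0 \<le> 1")
      case True
      then have "\<delta> = \<delta>0" by (simp add: \<delta>_def)
      then have "2 * \<delta> * M powr p = \<sigma> powr p"
        using critical_probability_moment[OF assms(1) \<epsilon> \<sigma>] by (simp add: M_def \<delta>0_def)
      then show ?thesis using rare_sign_moment_le[of p \<delta> M] assms(1) \<delta> M by simp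
    next
      \<comment> \<open>Here the sample is always \<open>s\<close>, and there is no noise.\<close>
      case False
      then show ?thesis by (simp add: \<delta>_def)
    qed
    have "3 / 4 \<le> real T * \<delta>"
    proof (rule sample_bound_rare_sign[OF d L \<delta> \<epsilon>])
      show "A (count_space UNIV) (noisy_quadratic d L M)
          \<in> PiM {..<T} (\<lambda>_. count_space UNIV) \<rightarrow>\<^sub>M prob_algebra (Rd d)"
        using alg unfolding global_stochastic_algorithm_def by blast
      show "expected_gradient_norm d T (A (count_space UNIV) (noisy_quadratic d L M))
          (noisy_quadratic d L (4 * \<epsilon> / \<delta>)) (measure_pmf (rare_sign \<delta> s)) \<le> ennreal \<epsilon>"
        if "\<bar>s\<bar> = 1" for s
        using success problem_instance_noisy_quadratic[OF d L _ \<delta>(2) M(1) that gap moment] \<delta>(1)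
        unfolding M_def by simp
    qed
    also have "\<dots> \<le> real T * \<delta>0" by (intro mult_left_mono) (auto simp: \<delta>_def)
    finally have "3 / 4 * (1 / \<delta>0) \<le> real T" using \<delta>0 by (simp add: field_simps)
    then show ?thesis
      using inverse_critical_probability[of p "\<sigma> / \<epsilon>"] assms(1) \<epsilon> \<sigma>
      by (simp add: \<delta>0_def)
  qed
qed

end
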